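(* Let $(M,+,\times)$ be an $\mathfrak{m}$-dioid, let $\varphi: M \to \mathbb{B}$ be the characteristic Boolean morphism, and let $T: M^k \to \mathbb{B}^k$ be the induced componentwise map $T(v_1,\dots,v_k) = (\varphi(v_1),\dots,\varphi(v_k))$. A collection $\{\mathbf{v}_i\}_{i\in I} \subseteq M^k$ is linearly attached if and only if $\{T(\mathbf{v}_i)\}_{i \in I} \subseteq \mathbb{B}^k$ is linearly attached.
   Context: A semiring is a triple $(S,+,\times)$ in which $(S,+)$ is a commutative monoid with identity $0$, $(S,\times)$ is a monoid with identity $1$, multiplication distributes over addition on both sides, and $a\times 0 = 0 \times a = 0$ for all $a$; it is commutative if $\times$ is commutative. The canonical preorder of $(S,+)$ is $a \le b$ iff $a+c=b$ for some $c$. A dioid is a semiring for which this preorder is a partial order. An $\mathfrak{m}$-dioid is a commutative dioid having an element $\mathfrak{m}\neq 0$ with $a\times\mathfrak{m}=\mathfrak{m}$ for all nonzero $a$. $\mathbb{B} = \{0,1\}$ is the Boolean semiring with $1+1=1$ (i.e. $(\{0,1\},\max,\min)$). The characteristic Boolean morphism $\varphi: M \to \mathbb{B}$ sends $0$ to $0$ and every nonzero element to $1$ (it is a semiring morphism for an $\mathfrak{m}$-dioid). For a semiring $S$, $S^k$ has componentwise addition and scalar multiplication. A collection $\{\mathbf{v}_i\}_{i\in I} \subseteq S^k$ is linearly attached if there exist disjoint finite subsets $A, B \subseteq I$, not both empty, and nonzero scalars $(\lambda_a)_{a\in A}$, $(\mu_b)_{b \in B}$ in $S$ such that $\sum_{a\in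 A} \lambda_a \mathbf{v}_a = \sum_{b \in B} \mu_b \mathbf{v}_b$ (an empty sum being the zero vector). *)

theory Defs
  imports "Jordan_Normal_Form.Matrix"
begin

(* Semirings are the sort {semiring_0, monoid_mult} rather than semiring_1, so that 0 = 1 is not
   excluded by definition. The canonical preorder is reflexive and transitive in any commutative
   monoid, so a dioid only has to require antisymmetry. *)

class dioid = semiring_0 + monoid_mult +
  assumes canonical_preorder_antisym:
    "antisymp (\<lambda>a b. \<exists>c. a + c = b)"

class m_dioid = dioid + comm_semiring_0 + comm_monoid_mult +
  assumes ex_absorbing: "\<exists>m. m \<noteq> 0 \<and> (\<forall>a. a \<noteq> 0 \<longrightarrow> a * m = m)"
begin

subclass comm_semiring_1
proof
  show "0 \<noteq> 1"
    using ex_absorbing by (metis mult_1_left mult_zero_left)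
qed

end

(* The Boolean semiring. (HOL-Library.Z2 is the field with 1 + 1 = 0, hence not suitable.) *)

instantiation bool :: comm_semiring_1
begin

definition "0 \<longleftrightarrow> False"
definition "1 \<longleftrightarrow> True"
definition "a + b \<longleftrightarrow> a \<or> b"
definition "a * b \<longleftrightarrow> a \<and> b"

instance
  by standard (auto simp: zero_bool_def one_bool_def plus_bool_def times_bool_def)

end

instance bool :: m_dioid
  by standard
    (auto simp: antisymp_def zero_bool_def one_bool_def plus_bool_def times_bool_def)

definition char_bool :: "'a::m_dioid \<Rightarrow> bool" where
  "char_bool a = (if a = 0 then 0 else 1)"

(* A collection is a family v indexed by I, so repeated vectors count as different members.
   The vectors v i are meant to lie in carrier_vec k for all i \<in> I; k is a parameter because it
   determines the value 0\<^sub>v k of an empty sum. *)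

definition linearly_attached ::
    "nat \<Rightarrow> 'i set \<Rightarrow> ('i \<Rightarrow> 'a::{semiring_0, monoid_mult} vec) \<Rightarrow> bool" where
  "linearly_attached k I v \<longleftrightarrow>
    (\<exists>A B l m. A \<subseteq> I \<and> B \<subseteq> I \<and> finite A \<and> finite B \<and> A \<inter> B = {} \<and> (A \<noteq> {} \<or> B \<noteq> {}) \<and>
      (\<forall>a\<in>A. l a \<noteq> 0) \<and> (\<forall>b\<in>B. m b \<noteq> 0) \<and>
      finsum_vec TYPE('a) k (\<lambda>a. l a \<cdot>\<^sub>v v a) A = finsum_vec TYPE('a) k (\<lambda>b. m b \<cdot>\<^sub>v v b) B)"

end

theory Submission
  imports Defs
begin

text \<open>In an m-dioid a sum of terms \<open>l\<^sub>a * x\<^sub>a\<close> with nonzero scalars \<open>l\<^sub>a\<close> vanishes iff all \<open>x\<^sub>a\<close> vanish,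
  and if all the scalars are the absorbing element then the sum takes only two values. Hence
  linear attachment is a condition on the zero patterns of the vectors alone, and
  componentwise application of the characteristic morphism preserves zero patterns.\<close>

text \<open>In the canonical preorder 0 lies below every element, and \<open>x + y = 0\<close> puts
  \<open>x\<close> below 0, so antisymmetry forces \<open>x = 0\<close>.\<close>

lemma add_eq_0_iff_dioid: "a + b = 0 \<longleftrightarrow> a = 0 \<and> b = (0::'a::dioid)"
proof
  assume ab: "a + b = 0"
  have "x = 0" if "x + y = 0" for x y :: 'a
    using antisympD[OF canonical_preorder_antisym, of x 0] that by auto
  from this[OF ab] this[of b a] ab show "a = 0 \<and> b = 0"
    by (simp add: add.commute)
qed simp

lemma sum_eq_0_iff_dioid:
  fixes f :: "'i \<Rightarrow> 'a::dioid"
  assumes "finite A"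
  shows "sum f A = 0 \<longleftrightarrow> (\<forall>a\<in>A. f a = 0)"
  using assms by (induction A) (auto simp: add_eq_0_iff_dioid)

text \<open>There are no zero divisors: multiplying the absorbing element \<open>m\<close> by
  \<open>b\<close> and then by \<open>a\<close>, both nonzero, leaves \<open>m\<close> in place,
  whereas \<open>a * b = 0\<close> would turn it into 0.\<close>

lemma mult_eq_0_iff_m_dioid: "a * b = 0 \<longleftrightarrow> a = 0 \<or> b = (0::'a::m_dioid)"
proof -
  obtain m :: 'a where m: "m \<noteq> 0" "\<And>a. a \<noteq> 0 \<Longrightarrow> a * m = m"
    using ex_absorbing by blast
  have "a * b \<noteq> 0" if "a \<noteq> 0" "b \<noteq> 0"
  proof
    assume "a * b = 0"
    moreover have "a * b * m = m"
      using m(2)[OF that(1)] m(2)[OF that(2)] by (simp add: mult.assoc)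
    ultimately show False
      using m(1) by simp
  qed
  then show ?thesis
    by auto
qed

lemma sum_mult_eq_0_iff_m_dioid:
  fixes l x :: "'i \<Rightarrow> 'a::m_dioid"
  assumes "finite A" "\<And>a. a \<in> A \<Longrightarrow> l a \<noteq> 0"
  shows "(\<Sum>a\<in>A. l a * x a) = 0 \<longleftrightarrow> (\<forall>a\<in>A. x a = 0)"
  using assms by (auto simp: sum_eq_0_iff_dioid mult_eq_0_iff_m_dioid)

text \<open>The factor \<open>m\<close> comes out of the sum, and \<open>sum x A\<close>, nonzero as
  soon as one term is, gets absorbed by it.\<close>

lemma sum_absorbing_mult:
  fixes m :: "'a::m_dioid"
  assumes "finite A" "m \<noteq> 0" "\<And>a. a \<noteq> 0 \<Longrightarrow> a * m = m"
  shows "(\<Sum>a\<in>A. m * x a) = (if \<forall>a\<in>A. x a = 0 then 0 else m)"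
proof -
  have "(\<Sum>a\<in>A. m * x a) = sum x A * m"
    by (simp add: sum_distrib_left mult.commute)
  then show ?thesis
    using assms by (auto simp: sum_eq_0_iff_dioid)
qed

text \<open>Passes from sums in the monoid of vectors of dimension \<open>k\<close> to ordinary sums
  of scalars, one for each coordinate.\<close>

lemma finsum_smult_vec_eq_iff:
  fixes v :: "'i \<Rightarrow> 'a::semiring_0 vec"
  assumes "finite A" "finite B"
    and "\<And>a. a \<in> A \<Longrightarrow> v a \<in> carrier_vec k" "\<And>b. b \<in> B \<Longrightarrow> v b \<in> carrier_vec k"
  shows "finsum_vec TYPE('a) k (\<lambda>a. l a \<cdot>\<^sub>v v a) A = finsum_vec TYPE('a) k (\<lambda>b. m b \<cdot>\<^sub>v v b) B
    \<longleftrightarrow> (\<forall>j<k. (\<Sum>a\<in>A. l a * v a $ j) = (\<Sum>b\<in>B. m b * v b $ j))"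
proof -
  have coord: "finsum_vec TYPE('a) k (\<lambda>a. c a \<cdot>\<^sub>v v a) C = vec k (\<lambda>j. \<Sum>a\<in>C. c a * v a $ j)"
    if "finite C" and C: "\<And>a. a \<in> C \<Longrightarrow> v a \<in> carrier_vec k" for c C
  proof (rule eq_vecI)
    have closed: "(\<lambda>a. c a \<cdot>\<^sub>v v a) \<in> C \<rightarrow> carrier_vec k"
      using C by auto
    have "finsum_vec TYPE('a) k (\<lambda>a. c a \<cdot>\<^sub>v v a) C \<in> carrier_vec k"
      using closed by (rule finsum_vec_closed)
    then show "dim_vec (finsum_vec TYPE('a) k (\<lambda>a. c a \<cdot>\<^sub>v v a) C)
        = dim_vec (vec k (\<lambda>j. \<Sum>a\<in>C. c a * v a $ j))"
      by simp
    fix j assume "j < dim_vec (vec k (\<lambda>j. \<Sum>a\<in>C. c a * v a $ j))"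
    then have "j < k" by simp
    then have "(c a \<cdot>\<^sub>v v a) $ j = c a * v a $ j" if "a \<in> C" for a
      using C[OF that] by simp
    with \<open>j < k\<close> show "finsum_vec TYPE('a) k (\<lambda>a. c a \<cdot>\<^sub>v v a) C $ j
        = vec k (\<lambda>j. \<Sum>a\<in>C. c a * v a $ j) $ j"
      using index_finsum_vec[OF \<open>finite C\<close> _ closed] by simp
  qed
  have vec_eq: "vec k f = vec k g \<longleftrightarrow> (\<forall>j<k. f j = g j)" for f g :: "nat \<Rightarrow> 'a"
    by (auto simp: vec_eq_iff)
  show ?thesis
    by (simp only: coord[OF assms(1,3)] coord[OF assms(2,4)] vec_eq)
qed

lemma linearly_attached_iff_zero_pattern:
  fixes v :: "'i \<Rightarrow> 'a::m_dioid vec"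
  assumes v: "\<And>i. i \<in> I \<Longrightarrow> v i \<in> carrier_vec k"
  shows "linearly_attached k I v \<longleftrightarrow>
    (\<exists>A B. A \<subseteq> I \<and> B \<subseteq> I \<and> finite A \<and> finite B \<and> A \<inter> B = {} \<and> (A \<noteq> {} \<or> B \<noteq> {}) \<and>
      (\<forall>j<k. (\<forall>a\<in>A. v a $ j = 0) \<longleftrightarrow> (\<forall>b\<in>B. v b $ j = 0)))"
proof -
  obtain m :: 'a where m: "m \<noteq> 0" "\<And>a. a \<noteq> 0 \<Longrightarrow> a * m = m"
    using ex_absorbing by blast
  \<comment> \<open>The scalars are eliminated for each fixed pair \<open>A\<close>,
    \<open>B\<close>. An empty set makes its side of \<open>?R\<close> vacuously true, in agreement
    with the empty sum being the zero vector.\<close>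
  have "(\<exists>l m. (\<forall>a\<in>A. l a \<noteq> 0) \<and> (\<forall>b\<in>B. m b \<noteq> 0) \<and>
        finsum_vec TYPE('a) k (\<lambda>a. l a \<cdot>\<^sub>v v a) A = finsum_vec TYPE('a) k (\<lambda>b. m b \<cdot>\<^sub>v v b) B)
      \<longleftrightarrow> (\<forall>j<k. (\<forall>a\<in>A. v a $ j = 0) \<longleftrightarrow> (\<forall>b\<in>B. v b $ j = 0))" (is "?L \<longleftrightarrow> ?R")
    if AB: "A \<subseteq> I" "B \<subseteq> I" "finite A" "finite B" for A B
  proof -
    have eq: "finsum_vec TYPE('a) k (\<lambda>a. l a \<cdot>\<^sub>v v a) A = finsum_vec TYPE('a) k (\<lambda>b. m b \<cdot>\<^sub>v v b) B
        \<longleftrightarrow> (\<forall>j<k. (\<Sum>a\<in>A. l a * v a $ j) = (\<Sum>b\<in>B. m b * v b $ j))" for l m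
      using AB v by (intro finsum_smult_vec_eq_iff) auto
    show ?thesis
    proof
      assume ?L
      then obtain l m where lm: "\<forall>a\<in>A. l a \<noteq> 0" "\<forall>b\<in>B. m b \<noteq> 0"
        and sums: "\<forall>j<k. (\<Sum>a\<in>A. l a * v a $ j) = (\<Sum>b\<in>B. m b * v b $ j)"
        unfolding eq by blast
      show ?R
      proof (intro allI impI)
        fix j assume "j < k"
        \<comment> \<open>Of the equality of the two sums only their simultaneous vanishing is kept,
          which does not depend on the choice of nonzero scalars.\<close>
        with sums have "(\<Sum>a\<in>A. l a * v a $ j) = 0 \<longleftrightarrow> (\<Sum>b\<in>B. m b * v b $ j) = 0"
          by simp
        then show "(\<forall>a\<in>A. v a $ j = 0) \<longleftrightarrow> (\<forall>b\<in>B. v b $ j = 0)"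
          using lm AB by (simp add: sum_mult_eq_0_iff_m_dioid)
      qed
    next
      assume ?R
      \<comment> \<open>Here \<open>m\<close> is the absorbing element, taken as every scalar: each
        sum is then 0 or \<open>m\<close>, so equal zero patterns give equal sums.\<close>
      then have "\<forall>j<k. (\<Sum>a\<in>A. m * v a $ j) = (\<Sum>b\<in>B. m * v b $ j)"
        by (simp add: sum_absorbing_mult[OF AB(3) m] sum_absorbing_mult[OF AB(4) m])
      then show ?L
        unfolding eq using m(1) by (intro exI[of _ "\<lambda>_. m"]) auto
    qed
  qed
  then show ?thesis
    \<comment> \<open>\<open>conj_cong\<close> supplies the inclusions and finiteness under which
      the scalars can be eliminated.\<close>
    unfolding linearly_attached_def by (simp cong: conj_cong)
qed

lemma char_bool_eq_0_iff: "char_bool a = 0 \<longleftrightarrow> a = 0"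
  by (simp add: char_bool_def)

theorem theorem3p8:
  fixes k :: nat and I :: "'i set" and v :: "'i \<Rightarrow> 'a::m_dioid vec"
  assumes "\<And>i. i \<in> I \<Longrightarrow> v i \<in> carrier_vec k"
  shows "linearly_attached k I v \<longleftrightarrow> linearly_attached k I (\<lambda>i. map_vec char_bool (v i))"
proof -
  have "map_vec char_bool (v i) $ j = 0 \<longleftrightarrow> v i $ j = 0" if "i \<in> I" "j < k" for i j
    using assms[OF that(1)] that(2) by (simp add: char_bool_eq_0_iff)
  then have zero: "(\<forall>a\<in>A. map_vec char_bool (v a) $ j = 0) \<longleftrightarrow> (\<forall>a\<in>A. v a $ j = 0)"
    if "A \<subseteq> I" "j < k" for A j
    using that by blast
  have carrier: "map_vec char_bool (v i) \<in> carrier_vec k" if "i \<in> I" for i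
    using assms[OF that] by simp
  have "linearly_attached k I (\<lambda>i. map_vec char_bool (v i)) \<longleftrightarrow>
    (\<exists>A B. A \<subseteq> I \<and> B \<subseteq> I \<and> finite A \<and> finite B \<and> A \<inter> B = {} \<and> (A \<noteq> {} \<or> B \<noteq> {}) \<and>
      (\<forall>j<k. (\<forall>a\<in>A. map_vec char_bool (v a) $ j = 0) \<longleftrightarrow>
        (\<forall>b\<in>B. map_vec char_bool (v b) $ j = 0)))"
    \<comment> \<open>The criterion is used at type \<open>bool\<close>, itself an m-dioid.\<close>
    using carrier by (rule linearly_attached_iff_zero_pattern)
  also have "\<dots> \<longleftrightarrow> linearly_attached k I v"
    \<comment> \<open>The same \<open>A\<close> and \<open>B\<close> serve on both sides, since the
      two criteria differ only by the equivalence \<open>zero\<close>.\<close>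
    by (simp add: linearly_attached_iff_zero_pattern[of I v k, OF assms] zero cong: conj_cong)
  finally show ?thesis ..
qed

end
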